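(* Let $X$ be a simplicial complex on vertex set $V$. Let $V_1,\ldots,V_k$ be subsets of $V$ with $V_i\notin X$ for all $i\in[k]$, such that for every missing face $\tau$ of $X$ there exists $i\in[k]$ with $|\tau\setminus V_i|\leq 1$. Then $X=\bigcap_{i=1}^k X_i$ where, for each $i\in[k]$, $X_i$ is a $(|V_i|-1)$-representable simplicial complex on vertex set $V$. In particular, $X$ is $\left(\sum_{i=1}^k(|V_i|-1)\right)$-representable.
   Context: A missing face of $X$ is a set $\tau\subset V$ with $\tau\notin X$ but $\sigma\in X$ for every $\sigma\subsetneq\tau$. The nerve of a family $\{F_v\}_{v\in V}$ is $\{\sigma\subset V:\bigcap_{v\in\sigma}F_v\neq\emptyset\}$; a complex is $d$-representable if it is isomorphic to the nerve of a finite family of compact convex sets in $\mathbb{R}^d$. *)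

theory Defs
  imports "HOL-Analysis.Analysis"
begin

(* A vertex v of V need not satisfy {v} \<in> X. *)
definition simplicial_complex_on :: "'a set \<Rightarrow> 'a set set \<Rightarrow> bool" where
  "simplicial_complex_on V X \<longleftrightarrow>
     finite V \<and> X \<subseteq> Pow V \<and> {} \<in> X \<and> (\<forall>\<sigma>\<in>X. \<forall>\<tau>. \<tau> \<subseteq> \<sigma> \<longrightarrow> \<tau> \<in> X)"

definition missing_face :: "'a set \<Rightarrow> 'a set set \<Rightarrow> 'a set \<Rightarrow> bool" where
  "missing_face V X \<tau> \<longleftrightarrow> \<tau> \<subseteq> V \<and> \<tau> \<notin> X \<and> (\<forall>\<sigma>. \<sigma> \<subset> \<tau> \<longrightarrow> \<sigma> \<in> X)"

(* The intersection over the empty subfamily is UNIV, so {} always belongs to the nerve. *)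
definition nerve :: "'i set \<Rightarrow> ('i \<Rightarrow> 'p set) \<Rightarrow> 'i set set" where
  "nerve W F = {\<sigma>. \<sigma> \<subseteq> W \<and> (\<Inter>w\<in>\<sigma>. F w) \<noteq> {}}"

definition complex_isomorphic ::
    "'a set \<Rightarrow> 'a set set \<Rightarrow> 'b set \<Rightarrow> 'b set set \<Rightarrow> bool" where
  "complex_isomorphic V X W Y \<longleftrightarrow>
     (\<exists>f. bij_betw f V W \<and> (\<forall>\<sigma>. \<sigma> \<subseteq> V \<longrightarrow> (\<sigma> \<in> X \<longleftrightarrow> f ` \<sigma> \<in> Y)))"

(* The points of Euclidean_space d are functions nat => real vanishing outside {..<d};
   nat => real is not an instance of real_vector, so convexity is written out pointwise. *)
definition convex_fun_set :: "(nat \<Rightarrow> real) set \<Rightarrow> bool" where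
  "convex_fun_set S \<longleftrightarrow>
     (\<forall>x\<in>S. \<forall>y\<in>S. \<forall>u\<ge>0. \<forall>v\<ge>0. u + v = 1 \<longrightarrow> (\<lambda>i. u * x i + v * y i) \<in> S)"

(* Indexing by a finite set of naturals loses no generality for finite families.
   The empty set is allowed as a member of the family. *)
definition representable :: "nat \<Rightarrow> 'a set \<Rightarrow> 'a set set \<Rightarrow> bool" where
  "representable d V X \<longleftrightarrow>
     (\<exists>(W :: nat set) F. finite W \<and>
        (\<forall>w\<in>W. compactin (Euclidean_space d) (F w) \<and> convex_fun_set (F w)) \<and>
        complex_isomorphic V X W (nerve W F))"

end

theory Submission
  imports Defs
begin

text \<open>Let \<open>Y\<^sub>i\<close> consist of the sets containing no missing face \<open>\<tau>\<close> of \<open>X\<close> with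
  \<open>card (\<tau> - U i) \<le> 1\<close>, so that \<open>X\<close> is the intersection of the \<open>Y\<^sub>i\<close>. For a set \<open>\<sigma>\<close> to lie in
  \<open>Y\<^sub>i\<close> it suffices that \<open>insert w (\<sigma> \<inter> U i) \<in> Y\<^sub>i\<close> for all \<open>w \<in> \<sigma>\<close>. Represent \<open>Y\<^sub>i\<close> inside the
  simplex of dimension \<open>card (U i) - 1\<close> with vertices indexed by \<open>U i\<close>: the polytope of \<open>w\<close> is cut
  out by the facet equation \<open>t\<^sub>w = 0\<close> (if \<open>w \<in> U i\<close>) and by \<open>(\<Sum>u\<in>A. t\<^sub>u) \<ge> 1 / card (U i)\<close> for
  all \<open>A \<subseteq> U i\<close> with \<open>insert w A \<notin> Y\<^sub>i\<close>. For \<open>\<sigma> \<in> Y\<^sub>i\<close> the barycentre of the face opposite to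
  \<open>\<sigma> \<inter> U i\<close>, which is nonempty because \<open>U i \<notin> Y\<^sub>i\<close>, is a common point. Cartesian products of the
  families represent intersections of complexes.\<close>

section \<open>Representability by families indexed by the vertices\<close>

lemma compactin_Euclidean_space_iff:
  "compactin (Euclidean_space d) S \<longleftrightarrow> compact S \<and> (\<forall>x\<in>S. \<forall>i\<ge>d. x i = 0)"
  unfolding Euclidean_space_def compactin_subtopology euclidean_product_topology
  by auto

text \<open>Pulling the family back along the isomorphism indexes it by \<open>V\<close>;
  conversely, an enumeration of the finite set \<open>V\<close> supplies the natural-number
  indices.\<close>

lemma representable_iff:
  assumes "finite V"
  shows "representable d V X \<longleftrightarrow>
    (\<exists>F. (\<forall>v\<in>V. compactin (Euclidean_space d) (F v) \<and> convex_fun_set (F v)) \<and>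
         (\<forall>\<sigma>\<subseteq>V. \<sigma> \<in> X \<longleftrightarrow> (\<Inter>v\<in>\<sigma>. F v) \<noteq> {}))"
    (is "_ \<longleftrightarrow> ?R")
proof
  assume "representable d V X"
  then obtain W :: "nat set" and F f where
    F: "\<forall>w\<in>W. compactin (Euclidean_space d) (F w) \<and> convex_fun_set (F w)"
    and f: "bij_betw f V W"
    and X: "\<forall>\<sigma>. \<sigma> \<subseteq> V \<longrightarrow> (\<sigma> \<in> X \<longleftrightarrow> f ` \<sigma> \<in> nerve W F)"
    unfolding representable_def complex_isomorphic_def by blast
  have "f ` V = W"
    using f by (simp add: bij_betw_def)
  then have "\<sigma> \<in> X \<longleftrightarrow> (\<Inter>v\<in>\<sigma>. (F \<circ> f) v) \<noteq> {}" if "\<sigma> \<subseteq> V" for \<sigma>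
    using X that by (auto simp: nerve_def image_comp)
  moreover have "\<forall>v\<in>V. compactin (Euclidean_space d) ((F \<circ> f) v) \<and> convex_fun_set ((F \<circ> f) v)"
    using F \<open>f ` V = W\<close> by auto
  ultimately show ?R
    by blast
next
  assume ?R
  then obtain F where
    F: "\<forall>v\<in>V. compactin (Euclidean_space d) (F v) \<and> convex_fun_set (F v)"
    and X: "\<forall>\<sigma>\<subseteq>V. \<sigma> \<in> X \<longleftrightarrow> (\<Inter>v\<in>\<sigma>. F v) \<noteq> {}"
    by blast
  obtain f where f: "bij_betw f V {0..<card V}"
    using ex_bij_betw_finite_nat[OF assms] by blast
  define W where "W = {0..<card V}"
  define g where "g = inv_into V f"
  have g: "g (f v) = v" if "v \<in> V" for v
    using f that by (simp add: g_def bij_betw_def)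
  have W: "W = f ` V"
    using f by (simp add: W_def bij_betw_def)
  have "\<sigma> \<in> X \<longleftrightarrow> f ` \<sigma> \<in> nerve W (F \<circ> g)" if "\<sigma> \<subseteq> V" for \<sigma>
  proof -
    have "(\<Inter>w\<in>f ` \<sigma>. (F \<circ> g) w) = (\<Inter>v\<in>\<sigma>. F v)"
      using g that by (simp add: subset_iff)
    then show ?thesis
      using X that W unfolding nerve_def by (auto simp del: INT_simps)
  qed
  moreover have "\<forall>w\<in>W. compactin (Euclidean_space d) ((F \<circ> g) w) \<and> convex_fun_set ((F \<circ> g) w)"
    using F g W by auto
  moreover have "finite W"
    by (simp add: W_def)
  moreover have "bij_betw f V W"
    using f by (simp add: W_def)
  ultimately show "representable d V X"
    unfolding representable_def complex_isomorphic_def by blast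
qed

text \<open>Base case for the intersection of no complexes: every vertex receives the single point
  of 0-dimensional space.\<close>

lemma representable_Pow:
  assumes "finite V"
  shows "representable 0 V (Pow V)"
  unfolding representable_iff[OF assms] compactin_Euclidean_space_iff
  by (rule exI[of _ "\<lambda>_. {\<lambda>_. 0}"]) (auto simp: convex_fun_set_def)

section \<open>Products of families and intersections of complexes\<close>

text \<open>Identifies R^d x R^e with R^(d+e). The argument is a pair so that the image of a
  Cartesian product can be formed. Only the first \<open>d\<close> coordinates of the first
  component survive.\<close>

definition append_coords :: "nat \<Rightarrow> (nat \<Rightarrow> real) \<times> (nat \<Rightarrow> real) \<Rightarrow> nat \<Rightarrow> real" where
  "append_coords d p = (\<lambda>i. if i < d then fst p i else snd p (i - d))"

lemma continuous_on_coord: "continuous_on S (\<lambda>x :: nat \<Rightarrow> real. x j)"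
  by (rule continuous_on_product_then_coordinatewise[OF continuous_on_id])

lemma continuous_on_append_coords: "continuous_on S (append_coords d)"
proof (rule continuous_on_coordinatewise_then_product)
  fix i
  have "continuous_on S ((\<lambda>x. x i) \<circ> fst)" "continuous_on S ((\<lambda>x. x (i - d)) \<circ> snd)"
    by (intro continuous_on_compose continuous_on_coord continuous_on_fst continuous_on_snd
        continuous_on_id)+
  then show "continuous_on S (\<lambda>p. append_coords d p i)"
    by (cases "i < d") (simp_all add: append_coords_def comp_def)
qed

text \<open>The vanishing assumptions restore the coordinates of the first component that
  \<open>append_coords\<close> discards.\<close>

lemma append_coords_inject:
  assumes "append_coords d (x, y) = append_coords d (x', y')"
    and "\<forall>i\<ge>d. x i = 0" "\<forall>i\<ge>d. x' i = 0"
  shows "x = x' \<and> y = y'"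
proof
  show "x = x'"
  proof
    fix i
    show "x i = x' i"
      using fun_cong[OF assms(1), of i] assms(2,3)
      by (cases "i < d") (auto simp: append_coords_def)
  qed
  show "y = y'"
  proof
    fix i
    show "y i = y' i"
      using fun_cong[OF assms(1), of "i + d"] by (auto simp: append_coords_def)
  qed
qed

lemma convex_append_coords:
  assumes "convex_fun_set S" "convex_fun_set T"
  shows "convex_fun_set (append_coords d ` (S \<times> T))"
  unfolding convex_fun_set_def
proof (intro ballI allI impI)
  fix a b and u v :: real
  assume ab: "a \<in> append_coords d ` (S \<times> T)" "b \<in> append_coords d ` (S \<times> T)"
    and uv: "0 \<le> u" "0 \<le> v" "u + v = 1"
  obtain x y x' y' where *: "x \<in> S" "y \<in> T" "x' \<in> S" "y' \<in> T"
    "a = append_coords d (x, y)" "b = append_coords d (x', y')"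
    using ab by auto
  have "(\<lambda>i. u * a i + v * b i)
      = append_coords d (\<lambda>i. u * x i + v * x' i, \<lambda>i. u * y i + v * y' i)"
    by (auto simp: * append_coords_def)
  moreover have "(\<lambda>i. u * x i + v * x' i) \<in> S" "(\<lambda>i. u * y i + v * y' i) \<in> T"
    using assms * uv unfolding convex_fun_set_def by blast+
  ultimately show "(\<lambda>i. u * a i + v * b i) \<in> append_coords d ` (S \<times> T)"
    by blast
qed

text \<open>For a nonempty face, the intersection of products is the product of the intersections,
  which is nonempty exactly when both factors are.\<close>

lemma representable_Int:
  assumes "finite V" "representable d V X" "representable e V Y"
  shows "representable (d + e) V (X \<inter> Y)"
proof -
  obtain F where F: "\<And>v. v \<in> V \<Longrightarrow> compactin (Euclidean_space d) (F v)"
      "\<And>v. v \<in> V \<Longrightarrow> convex_fun_set (F v)"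
    and X: "\<And>\<sigma>. \<sigma> \<subseteq> V \<Longrightarrow> \<sigma> \<in> X \<longleftrightarrow> (\<Inter>v\<in>\<sigma>. F v) \<noteq> {}"
    using assms(2) unfolding representable_iff[OF assms(1)] by blast
  obtain G where G: "\<And>v. v \<in> V \<Longrightarrow> compactin (Euclidean_space e) (G v)"
      "\<And>v. v \<in> V \<Longrightarrow> convex_fun_set (G v)"
    and Y: "\<And>\<sigma>. \<sigma> \<subseteq> V \<Longrightarrow> \<sigma> \<in> Y \<longleftrightarrow> (\<Inter>v\<in>\<sigma>. G v) \<noteq> {}"
    using assms(3) unfolding representable_iff[OF assms(1)] by blast
  define H where "H v = append_coords d ` (F v \<times> G v)" for v
  have compact: "compactin (Euclidean_space (d + e)) (H v)" if "v \<in> V" for v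
  proof -
    have "compact (H v)"
      using F(1)[OF that] G(1)[OF that] unfolding H_def compactin_Euclidean_space_iff
      by (intro compact_continuous_image continuous_on_append_coords compact_Times) auto
    then show ?thesis
      using G(1)[OF that] by (auto simp: compactin_Euclidean_space_iff H_def append_coords_def)
  qed
  have convex: "convex_fun_set (H v)" if "v \<in> V" for v
    unfolding H_def using F(2)[OF that] G(2)[OF that] by (rule convex_append_coords)
  have "\<sigma> \<in> X \<inter> Y \<longleftrightarrow> (\<Inter>v\<in>\<sigma>. H v) \<noteq> {}" if \<sigma>: "\<sigma> \<subseteq> V" for \<sigma>
  proof
    assume "\<sigma> \<in> X \<inter> Y"
    then obtain x y where "\<forall>v\<in>\<sigma>. x \<in> F v" "\<forall>v\<in>\<sigma>. y \<in> G v"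
      using X[OF \<sigma>] Y[OF \<sigma>] by auto
    then have "append_coords d (x, y) \<in> (\<Inter>v\<in>\<sigma>. H v)"
      by (auto simp: H_def)
    then show "(\<Inter>v\<in>\<sigma>. H v) \<noteq> {}"
      by blast
  next
    assume "(\<Inter>v\<in>\<sigma>. H v) \<noteq> {}"
    then obtain z where z: "\<And>v. v \<in> \<sigma> \<Longrightarrow> z \<in> H v"
      by blast
    \<comment> \<open>For the empty face any two points serve. Otherwise \<open>z\<close> is split
      at one vertex \<open>w\<close>, and injectivity makes its splitting at every other vertex the
      same.\<close>
    have "\<exists>x y. \<forall>v\<in>\<sigma>. x \<in> F v \<and> y \<in> G v"
    proof (cases "\<sigma> = {}")
      case False
      then obtain w where w: "w \<in> \<sigma>"
        by blast
      then obtain x y where xy: "z = append_coords d (x, y)" "x \<in> F w"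
        using z[OF w] by (auto simp: H_def)
      have "x \<in> F v \<and> y \<in> G v" if v: "v \<in> \<sigma>" for v
      proof -
        obtain x' y' where xy': "z = append_coords d (x', y')" "x' \<in> F v" "y' \<in> G v"
          using z[OF v] by (auto simp: H_def)
        have "\<forall>i\<ge>d. x i = 0" "\<forall>i\<ge>d. x' i = 0"
          using F(1) xy(2) xy'(2) v w \<sigma> unfolding compactin_Euclidean_space_iff by blast+
        then have "x = x' \<and> y = y'"
          using append_coords_inject xy(1) xy'(1) by metis
        then show ?thesis
          using xy' by blast
      qed
      then show ?thesis
        by blast
    qed auto
    then show "\<sigma> \<in> X \<inter> Y"
      using X[OF \<sigma>] Y[OF \<sigma>] by blast
  qed
  then show ?thesis
    unfolding representable_iff[OF assms(1)] using compact convex by blast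
qed

text \<open>Induction on \<open>I\<close> by binary intersections. \<open>Pow V\<close> is the value
  for empty \<open>I\<close> and contributes dimension 0.\<close>

lemma representable_INT:
  assumes "finite V" "finite I" "\<And>i. i \<in> I \<Longrightarrow> representable (d i) V (Y i)"
  shows "representable (\<Sum>i\<in>I. d i) V (Pow V \<inter> (\<Inter>i\<in>I. Y i))"
  using assms(2,3)
proof (induction I rule: finite_induct)
  case empty
  then show ?case
    using representable_Pow[OF assms(1)] by simp
next
  case (insert i I)
  have "representable (d i + (\<Sum>i\<in>I. d i)) V (Y i \<inter> (Pow V \<inter> (\<Inter>i\<in>I. Y i)))"
    using insert by (intro representable_Int assms(1)) auto
  moreover have "Y i \<inter> (Pow V \<inter> (\<Inter>i\<in>I. Y i)) = Pow V \<inter> (\<Inter>i\<in>insert i I. Y i)"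
    by auto
  ultimately show ?case
    using insert by simp
qed

section \<open>The simplex and its barycentric coordinates\<close>

text \<open>Barycentric coordinates with respect to the origin, which has index \<open>d\<close>, and the first \<open>d\<close>
  standard unit vectors.\<close>

definition bary_coord :: "nat \<Rightarrow> nat \<Rightarrow> (nat \<Rightarrow> real) \<Rightarrow> real" where
  "bary_coord d j x = (if j < d then x j else 1 - (\<Sum>i<d. x i))"

definition simplex_fun_set :: "nat \<Rightarrow> (nat \<Rightarrow> real) set" where
  "simplex_fun_set d = {x. (\<forall>i\<ge>d. x i = 0) \<and> (\<forall>j\<le>d. 0 \<le> bary_coord d j x)}"

lemma continuous_on_bary_coord: "continuous_on S (bary_coord d j)"
  unfolding bary_coord_def
  by (cases "j < d")
    (simp_all add: continuous_on_coord continuous_on_diff continuous_on_sum)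

lemma bary_coord_affine:
  assumes "u + v = 1"
  shows "bary_coord d j (\<lambda>i. u * x i + v * y i) = u * bary_coord d j x + v * bary_coord d j y"
proof -
  have "1 - (u * s + v * t) = u * (1 - s) + v * (1 - t)" for s t
    using assms by (simp add: algebra_simps)
  then show ?thesis
    by (simp add: bary_coord_def sum.distrib flip: sum_distrib_left)
qed

text \<open>The simplex is a closed subset of the cube \<open>B\<close>, which is compact by
  Tychonoff's theorem.\<close>

lemma compact_simplex_fun_set: "compact (simplex_fun_set d)"
proof -
  define B :: "(nat \<Rightarrow> real) set" where "B = (\<Pi>\<^sub>E i\<in>UNIV. if i < d then {0..1} else {0})"
  have "compact B"
    using compactin_PiE[of "\<lambda>_. euclidean" UNIV "\<lambda>i. if i < d then {0..1} else {0::real}"]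
    unfolding B_def euclidean_product_topology by auto
  have "closed (simplex_fun_set d)"
    unfolding simplex_fun_set_def
    by (intro closed_Collect_conj closed_Collect_all closed_Collect_imp closed_Collect_le
        closed_Collect_eq open_Collect_const continuous_on_bary_coord continuous_intros)
      auto
  moreover have "simplex_fun_set d \<subseteq> B"
  proof
    fix x assume x: "x \<in> simplex_fun_set d"
    then have coord: "0 \<le> bary_coord d j x" if "j \<le> d" for j
      using that by (simp add: simplex_fun_set_def)
    have nonneg: "0 \<le> x i" if "i < d" for i
      using coord[of i] that by (simp add: bary_coord_def)
    \<comment> \<open>This is nonnegativity of the barycentric coordinate with index
      \<open>d\<close>; it bounds each single coordinate through the sum.\<close>
    have "(\<Sum>i<d. x i) \<le> 1"
      using coord[of d] by (simp add: bary_coord_def)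
    moreover have "x i \<le> (\<Sum>i<d. x i)" if "i < d" for i
      using nonneg that by (intro member_le_sum) auto
    ultimately show "x \<in> B"
      using x nonneg by (force simp: B_def simplex_fun_set_def)
  qed
  ultimately show ?thesis
    using \<open>compact B\<close> by (metis compact_Int_closed inf.absorb_iff2)
qed

text \<open>The vector is the barycentre of the face spanned by \<open>C\<close>. The weight of
  index \<open>d\<close> is not stored as a coordinate, hence the guard \<open>i < d\<close>; it
  reappears as the complement of the other weights to 1.\<close>

lemma bary_coord_barycentre:
  assumes "C \<subseteq> {..d}" "C \<noteq> {}" "j \<le> d"
  shows "bary_coord d j (\<lambda>i. if i < d \<and> i \<in> C then 1 / card C else 0)
    = (if j \<in> C then 1 / card C else 0)"
proof (cases "j < d")
  case False
  then have "j = d"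
    using assms(3) by simp
  have fin: "finite C"
    using assms(1) finite_subset by blast
  then have pos: "card C > 0"
    using assms(2) by (simp add: card_gt_0_iff)
  have "(\<Sum>i<d. if i < d \<and> i \<in> C then 1 / real (card C) else 0)
      = (\<Sum>i\<in>{..<d} \<inter> C. 1 / real (card C))"
    by (subst sum.inter_restrict) (auto intro!: sum.cong)
  also have "{..<d} \<inter> C = C - {d}"
    using assms(1) by force
  finally have "(\<Sum>i<d. if i < d \<and> i \<in> C then 1 / real (card C) else 0)
      = card (C - {d}) / card C"
    by simp
  then show ?thesis
    using fin pos by (auto simp: bary_coord_def \<open>j = d\<close> card_Diff_singleton_if field_simps of_nat_diff)
qed (simp add: bary_coord_def)

section \<open>Representation by polytopes in a simplex\<close>

text \<open>The inequalities only exclude nonfaces of the form \<open>insert w A\<close> with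
  \<open>A \<subseteq> U\<close>; \<open>link\<close> says that such sets detect every
  nonface.\<close>

lemma representable_of_links:
  assumes Y: "simplicial_complex_on V Y" and UV: "U \<subseteq> V" and UY: "U \<notin> Y"
    and link: "\<And>\<sigma>. \<sigma> \<subseteq> V \<Longrightarrow> \<sigma> \<noteq> {} \<Longrightarrow> (\<And>w. w \<in> \<sigma> \<Longrightarrow> insert w (\<sigma> \<inter> U) \<in> Y) \<Longrightarrow> \<sigma> \<in> Y"
  shows "representable (card U - 1) V Y"
proof -
  have V: "finite V" and empty: "{} \<in> Y" and down: "\<And>\<sigma> \<tau>. \<sigma> \<in> Y \<Longrightarrow> \<tau> \<subseteq> \<sigma> \<Longrightarrow> \<tau> \<in> Y"
    using Y by (auto simp: simplicial_complex_on_def)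
  define d where "d = card U - 1"
  have U: "finite U" "U \<noteq> {}"
    using V UV finite_subset UY empty by auto
  \<comment> \<open>\<open>U\<close> is nonempty because \<open>{} \<in> Y\<close>, so the
    subtraction defining \<open>d\<close> is not truncated.\<close>
  then have cardU: "card U = Suc d"
    by (simp add: d_def card_gt_0_iff)
  then obtain f where "bij_betw f U {0..<Suc d}"
    using ex_bij_betw_finite_nat[OF U(1)] by metis
  then have inj: "inj_on f U" and im: "f ` U = {..d}"
    by (auto simp: bij_betw_def)
  define t where "t u = bary_coord d (f u)" for u
  \<comment> \<open>The bound \<open>1 / Suc d\<close> is the least weight that the barycentre of a
    nonempty face gives to a vertex of that face. Being positive, it is violated when all summands
    vanish.\<close>
  define F where "F w = {x \<in> simplex_fun_set d. (w \<in> U \<longrightarrow> t w x = 0) \<and>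
      (\<forall>A. A \<subseteq> U \<and> insert w A \<notin> Y \<longrightarrow> 1 / Suc d \<le> (\<Sum>u\<in>A. t u x))}" for w
  have compact: "compactin (Euclidean_space d) (F w)" for w
  proof -
    have "closed {x. (w \<in> U \<longrightarrow> t w x = 0) \<and>
      (\<forall>A. A \<subseteq> U \<and> insert w A \<notin> Y \<longrightarrow> 1 / Suc d \<le> (\<Sum>u\<in>A. t u x))}"
      unfolding t_def
      by (intro closed_Collect_conj closed_Collect_all closed_Collect_imp closed_Collect_le
          closed_Collect_eq open_Collect_const continuous_on_bary_coord continuous_intros)
    with compact_simplex_fun_set have "compact (simplex_fun_set d \<inter> {x. (w \<in> U \<longrightarrow> t w x = 0) \<and>
      (\<forall>A. A \<subseteq> U \<and> insert w A \<notin> Y \<longrightarrow> 1 / Suc d \<le> (\<Sum>u\<in>A. t u x))})"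
      by (rule compact_Int_closed)
    then have "compact (F w)"
      by (simp add: F_def Int_def)
    then show ?thesis
      by (auto simp: compactin_Euclidean_space_iff F_def simplex_fun_set_def)
  qed
  \<comment> \<open>Each \<open>t u\<close> is affine, so all constraints are affine equations and
    weak inequalities.\<close>
  have convex: "convex_fun_set (F w)" for w
    unfolding convex_fun_set_def
  proof (intro ballI allI impI)
    fix x y and a b :: real
    assume x: "x \<in> F w" and y: "y \<in> F w" and ab: "0 \<le> a" "0 \<le> b" "a + b = 1"
    let ?z = "\<lambda>i. a * x i + b * y i"
    have "?z \<in> simplex_fun_set d"
      using x y ab by (auto simp: F_def simplex_fun_set_def bary_coord_affine)
    moreover have "w \<in> U \<longrightarrow> t w ?z = 0"
      using x y ab by (auto simp: F_def t_def bary_coord_affine)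
    moreover have "1 / Suc d \<le> (\<Sum>u\<in>A. t u ?z)" if "A \<subseteq> U" "insert w A \<notin> Y" for A
    proof -
      have "a * (1 / Suc d) + b * (1 / Suc d) \<le> a * (\<Sum>u\<in>A. t u x) + b * (\<Sum>u\<in>A. t u y)"
        using x y ab that by (intro add_mono mult_left_mono) (auto simp: F_def)
      also have "\<dots> = (\<Sum>u\<in>A. t u ?z)"
        using ab by (simp add: t_def bary_coord_affine sum.distrib sum_distrib_left)
      finally show ?thesis
        using ab by (simp flip: distrib_right add_divide_distrib)
    qed
    ultimately show "?z \<in> F w"
      by (simp add: F_def)
  qed
  have "\<sigma> \<in> Y \<longleftrightarrow> (\<Inter>w\<in>\<sigma>. F w) \<noteq> {}" if \<sigma>: "\<sigma> \<subseteq> V" for \<sigma>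
  proof
    assume "\<sigma> \<in> Y"
    define C where "C = f ` (U - \<sigma>)"
    have "\<not> U \<subseteq> \<sigma>"
      using \<open>\<sigma> \<in> Y\<close> UY down by blast
    then have C: "C \<subseteq> {..d}" "C \<noteq> {}"
      using im by (auto simp: C_def)
    then have "card C > 0" "card C \<le> Suc d"
      using card_mono[OF _ C(1)] finite_subset[OF C(1)] by (auto simp: card_gt_0_iff)
    then have cC: "1 / Suc d \<le> 1 / card C"
      by (simp add: frac_le)
    define b where "b = (\<lambda>i. if i < d \<and> i \<in> C then 1 / real (card C) else 0)"
    have tb: "t u b = (if u \<in> \<sigma> then 0 else 1 / card C)" if "u \<in> U" for u
    proof -
      have "f u \<in> C \<longleftrightarrow> u \<notin> \<sigma>"
        using inj that by (auto simp: C_def inj_on_def)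
      moreover have "f u \<le> d"
        using im that by blast
      ultimately show ?thesis
        using bary_coord_barycentre[OF C] by (simp add: t_def b_def)
    qed
    have "b \<in> F w" if w: "w \<in> \<sigma>" for w
    proof -
      have "0 \<le> bary_coord d j b" if "j \<le> d" for j
        using bary_coord_barycentre[OF C that] by (simp add: b_def)
      then have "b \<in> simplex_fun_set d"
        by (simp add: simplex_fun_set_def b_def)
      moreover have "w \<in> U \<longrightarrow> t w b = 0"
        using tb w by simp
      moreover have "1 / Suc d \<le> (\<Sum>u\<in>A. t u b)" if A: "A \<subseteq> U" "insert w A \<notin> Y" for A
      proof -
        \<comment> \<open>The nonface \<open>insert w A\<close> cannot lie inside the face
          \<open>\<sigma>\<close>. Since \<open>w \<in> \<sigma>\<close>, a vertex of
          \<open>A\<close> lies outside, and its weight \<open>1 / card C\<close> alone meets the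
          bound.\<close>
        obtain u where u: "u \<in> A" "u \<notin> \<sigma>"
          using A down[OF \<open>\<sigma> \<in> Y\<close>, of "insert w A"] w by blast
        have "t u b \<le> (\<Sum>u\<in>A. t u b)"
          using A u tb finite_subset[OF A(1) U(1)] by (intro member_le_sum) auto
        then show ?thesis
          using cC tb[of u] u A by auto
      qed
      ultimately show ?thesis
        by (simp add: F_def)
    qed
    then show "(\<Inter>w\<in>\<sigma>. F w) \<noteq> {}"
      by blast
  next
    assume "(\<Inter>w\<in>\<sigma>. F w) \<noteq> {}"
    then obtain x where x: "\<And>w. w \<in> \<sigma> \<Longrightarrow> x \<in> F w"
      by blast
    \<comment> \<open>The inequality for \<open>A = \<sigma> \<inter> U\<close> would fail: every
      \<open>u\<close> in this set is a vertex of \<open>\<sigma>\<close>, so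
      \<open>x \<in> F u\<close> forces \<open>t u x = 0\<close>.\<close>
    have "insert w (\<sigma> \<inter> U) \<in> Y" if "w \<in> \<sigma>" for w
    proof (rule ccontr)
      assume "insert w (\<sigma> \<inter> U) \<notin> Y"
      then have "1 / Suc d \<le> (\<Sum>u\<in>\<sigma> \<inter> U. t u x)"
        using x[OF that] by (simp add: F_def)
      also have "(\<Sum>u\<in>\<sigma> \<inter> U. t u x) = 0"
        using x by (intro sum.neutral) (auto simp: F_def)
      finally show False
        by simp
    qed
    then show "\<sigma> \<in> Y"
      using link[OF \<sigma>] empty by blast
  qed
  then show ?thesis
    unfolding representable_iff[OF V] d_def[symmetric] using compact convex by blast
qed

section \<open>Missing faces and the decomposition of the complex\<close>

text \<open>Passing to a proper subset outside \<open>X\<close> as long as there is one must stop,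
  by finiteness, at a minimal nonface.\<close>

lemma missing_face_subset:
  assumes "finite \<sigma>" "\<sigma> \<subseteq> V" "\<sigma> \<notin> X"
  obtains \<tau> where "missing_face V X \<tau>" "\<tau> \<subseteq> \<sigma>"
proof -
  have "\<exists>\<tau>. missing_face V X \<tau> \<and> \<tau> \<subseteq> \<sigma>"
    using assms
  proof (induction \<sigma> rule: finite_psubset_induct)
    case (psubset \<sigma>)
    show ?case
    proof (cases "missing_face V X \<sigma>")
      case False
      then obtain \<rho> where \<rho>: "\<rho> \<subset> \<sigma>" "\<rho> \<notin> X"
        using psubset.prems by (auto simp: missing_face_def)
      moreover from \<rho>(1) psubset.prems(1) have "\<rho> \<subseteq> V"
        by blast
      ultimately obtain \<tau> where "missing_face V X \<tau>" "\<tau> \<subseteq> \<rho>"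
        using psubset.IH[OF \<rho>(1)] by blast
      with \<rho>(1) show ?thesis
        by (intro exI[of _ \<tau>]) auto
    qed auto
  qed
  with that show thesis
    by blast
qed

theorem theorem1p4:
  fixes V :: "'a set" and X :: "'a set set" and k :: nat and U :: "nat \<Rightarrow> 'a set"
  assumes "simplicial_complex_on V X"
    and "\<And>i. i \<in> {1..k} \<Longrightarrow> U i \<subseteq> V"
    and "\<And>i. i \<in> {1..k} \<Longrightarrow> U i \<notin> X"
    and "\<And>\<tau>. missing_face V X \<tau> \<Longrightarrow> \<exists>i\<in>{1..k}. card (\<tau> - U i) \<le> 1"
  shows "(\<exists>Y :: nat \<Rightarrow> 'a set set.
            (\<forall>i\<in>{1..k}. simplicial_complex_on V (Y i) \<and> representable (card (U i) - 1) V (Y i)) \<and>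
            X = Pow V \<inter> (\<Inter>i\<in>{1..k}. Y i))
         \<and> representable (\<Sum>i=1..k. (card (U i) - 1)) V X"
proof -
  have V: "finite V" and XV: "X \<subseteq> Pow V" and empty: "{} \<in> X"
    and down: "\<And>\<sigma> \<tau>. \<sigma> \<in> X \<Longrightarrow> \<tau> \<subseteq> \<sigma> \<Longrightarrow> \<tau> \<in> X"
    using assms(1) by (auto simp: simplicial_complex_on_def)
  have not_face: "\<tau> \<notin> X" if "missing_face V X \<tau>" for \<tau>
    using that by (simp add: missing_face_def)
  define Y where
    "Y i = {\<sigma>. \<sigma> \<subseteq> V \<and> (\<forall>\<tau>. missing_face V X \<tau> \<and> card (\<tau> - U i) \<le> 1 \<longrightarrow> \<not> \<tau> \<subseteq> \<sigma>)}" for i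
  have complex: "simplicial_complex_on V (Y i)" for i
    unfolding simplicial_complex_on_def
  proof (intro conjI ballI allI impI)
    show "{} \<in> Y i"
      using empty not_face by (auto simp: Y_def)
    show "\<tau> \<in> Y i" if "\<sigma> \<in> Y i" "\<tau> \<subseteq> \<sigma>" for \<sigma> \<tau>
      using that unfolding Y_def by blast
  qed (use V in \<open>auto simp: Y_def\<close>)
  have rep: "representable (card (U i) - 1) V (Y i)" if i: "i \<in> {1..k}" for i
  proof (rule representable_of_links[OF complex assms(2)[OF i]])
    \<comment> \<open>A missing face inside \<open>U i\<close> has no vertex outside
      \<open>U i\<close>, so it is among those that \<open>Y i\<close> forbids.\<close>
    obtain \<tau> where \<tau>: "missing_face V X \<tau>" "\<tau> \<subseteq> U i"
      using missing_face_subset[OF finite_subset[OF assms(2)[OF i] V] assms(2)[OF i] assms(3)[OF i]] .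
    have "card (\<tau> - U i) = 0"
      using \<tau>(2) by (metis Diff_eq_empty_iff card.empty)
    then show "U i \<notin> Y i"
      using \<tau> by (auto simp: Y_def)
  next
    fix \<sigma>
    assume \<sigma>: "\<sigma> \<subseteq> V" "\<sigma> \<noteq> {}" and link: "\<And>w. w \<in> \<sigma> \<Longrightarrow> insert w (\<sigma> \<inter> U i) \<in> Y i"
    show "\<sigma> \<in> Y i"
    proof (rule ccontr)
      assume "\<sigma> \<notin> Y i"
      then obtain \<tau> where \<tau>: "missing_face V X \<tau>" "card (\<tau> - U i) \<le> 1" "\<tau> \<subseteq> \<sigma>"
        using \<sigma> by (auto simp: Y_def)
      \<comment> \<open>Excludes the default value 0 of \<open>card\<close> on infinite
        sets.\<close>
      have "finite (\<tau> - U i)"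
        using \<tau>(3) \<sigma>(1) V by (meson finite_Diff finite_subset)
      \<comment> \<open>\<open>w\<close> is the only vertex of \<open>\<tau>\<close> outside
        \<open>U i\<close> if there is one, and any vertex of the nonempty \<open>\<sigma>\<close>
        otherwise.\<close>
      then obtain w where "w \<in> \<sigma>" "\<tau> - U i \<subseteq> {w}"
        using \<tau>(2,3) \<sigma>(2) card_le_Suc0_iff_eq[of "\<tau> - U i"]
        by (cases "\<tau> - U i = {}") auto
      then have "\<tau> \<subseteq> insert w (\<sigma> \<inter> U i)"
        using \<tau>(3) by blast
      then show False
        using link[OF \<open>w \<in> \<sigma>\<close>] \<tau> by (auto simp: Y_def)
    qed
  qed
  have X: "X = Pow V \<inter> (\<Inter>i\<in>{1..k}. Y i)"
  proof
    \<comment> \<open>A missing face contained in a face of \<open>X\<close> would itself be a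
      face.\<close>
    have "\<sigma> \<in> Y i" if "\<sigma> \<in> X" for \<sigma> i
      unfolding Y_def using that XV not_face down[OF that] by blast
    then show "X \<subseteq> Pow V \<inter> (\<Inter>i\<in>{1..k}. Y i)"
      using XV by blast
    show "Pow V \<inter> (\<Inter>i\<in>{1..k}. Y i) \<subseteq> X"
    proof
      fix \<sigma> assume \<sigma>: "\<sigma> \<in> Pow V \<inter> (\<Inter>i\<in>{1..k}. Y i)"
      show "\<sigma> \<in> X"
      proof (rule ccontr)
        assume "\<sigma> \<notin> X"
        have "\<sigma> \<subseteq> V"
          using \<sigma> by blast
        \<comment> \<open>A nonface contains a missing face, and the covering hypothesis yields an
          \<open>i\<close> for which \<open>Y i\<close> forbids it.\<close>
        obtain \<tau> where \<tau>: "missing_face V X \<tau>" "\<tau> \<subseteq> \<sigma>"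
          using missing_face_subset[OF finite_subset[OF \<open>\<sigma> \<subseteq> V\<close> V] \<open>\<sigma> \<subseteq> V\<close> \<open>\<sigma> \<notin> X\<close>] .
        then obtain i where "i \<in> {1..k}" "card (\<tau> - U i) \<le> 1"
          using assms(4) by blast
        moreover from this have "\<sigma> \<in> Y i"
          using \<sigma> by blast
        ultimately show False
          using \<tau> unfolding Y_def by blast
      qed
    qed
  qed
  have "representable (\<Sum>i=1..k. (card (U i) - 1)) V (Pow V \<inter> (\<Inter>i\<in>{1..k}. Y i))"
    by (rule representable_INT) (use V rep in auto)
  then have "representable (\<Sum>i=1..k. (card (U i) - 1)) V X"
    unfolding X[symmetric] .
  then show ?thesis
    using complex rep X by blast
qed

end
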